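(* Let $q$ be a prime power, let $\ell$ be a positive divisor of $q-1$, put $s=\frac{q-1}{\ell}$, let $\gamma$ be a primitive element of $\mathbb{F}_q$ and $\zeta=\gamma^s$ (a primitive $\ell$-th root of unity). Let $A_0,\ldots,A_{\ell-1}\in\mathbb{F}_q^*$ and let $r_0,\ldots,r_{\ell-1}$ be positive integers. Then the polynomial \[ P(x)=\frac{1}{\ell}\sum_{i=0}^{\ell-1}\sum_{j=0}^{\ell-1}A_i\,\zeta^{-ji}\,x^{r_i+js}\in\mathbb{F}_q[x] \] is an involution of $\mathbb{F}_q$ (i.e. $P(P(x))=x$ for all $x\in\mathbb{F}_q$) if and only if all of the following hold: (i) for each $i=0,1,\ldots,\ell-1$ there exist integers $g_i,t_i$ such that $r_ig_i+st_i=1$; (ii) the set $\{\varphi(i) : i=0,\ldots,\ell-1\}$, where $\varphi(i)=\big(\mathrm{ind}_\gamma(A_i)+i r_i\big)\bmod \ell$, is a complete set of residues modulo $\ell$; (iii) $r_{\varphi(i)}\equiv r_i^{-1}\equiv g_i \pmod{s}$ for every $i=0,1,\ldots,\ell-1$; (iv) $A_{\varphi(i)}=A_i^{-g_i}\zeta^{i t_i}$ for every $i=0,1,\ldots,\ell-1$, where $g_i,t_i$ are the integers from (i).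
   Context: For $A\in\mathbb{F}_q^*$, $\mathrm{ind}_\gamma(A)$ denotes the discrete logarithm of $A$ with respect to $\gamma$, i.e. the integer $0\le e\le q-2$ with $\gamma^e=A$. For an integer $n$, $n\bmod \ell$ denotes the integer $m$ with $0\le m<\ell$ and $m\equiv n\pmod{\ell}$. $r_i^{-1}$ denotes the inverse of $r_i$ modulo $s$.
   Formalization: As printed the criterion fails, since (iv) depends on g_i beyond its class mod s (q=17, γ=3, ℓ=2, A=(1,13), r=(1,1), g=(1,9), t=(0,-1)); the proved version asks for g_i, t_i satisfying (i)-(iv) and also g_i ≡ r_{φ(i)} mod q-1. *)

theory Defs
  imports "HOL-Library.Cardinality" "HOL-Number_Theory.Number_Theory" "HOL-Computational_Algebra.Polynomial"
begin

definition primitive_element :: "'a::{field,finite} \<Rightarrow> bool" where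
  "primitive_element \<gamma> \<longleftrightarrow> \<gamma> \<noteq> 0 \<and> (\<forall>a. a \<noteq> 0 \<longrightarrow> (\<exists>n::nat. a = \<gamma> ^ n))"

(* Meaningful when \<gamma> is primitive and a is nonzero; the bound makes e unique. *)
definition ind :: "'a::{field,finite} \<Rightarrow> 'a \<Rightarrow> nat" where
  "ind \<gamma> a = (THE e. e \<le> CARD('a) - 2 \<and> \<gamma> ^ e = a)"

definition complete_residue_set :: "nat \<Rightarrow> nat set \<Rightarrow> bool" where
  "complete_residue_set m S \<longleftrightarrow> (\<forall>n. \<exists>!k. k \<in> S \<and> [k = n] (mod m))"

definition cyc_poly ::
  "'a::{field,finite} \<Rightarrow> nat \<Rightarrow> (nat \<Rightarrow> 'a) \<Rightarrow> (nat \<Rightarrow> nat) \<Rightarrow> 'a poly" where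
  "cyc_poly \<gamma> l A r =
     (let s = (CARD('a) - 1) div l; \<zeta> = \<gamma> ^ s in
      smult (1 / of_nat l)
        (\<Sum>i<l. \<Sum>j<l. monom (A i * \<zeta> powi (- (int j * int i))) (r i + j * s)))"

(* Congruence modulo s determines the Bezout coefficient g i only up to multiples of s,
   whereas replacing g i by g i + m * s (and t i by t i - m * r i) changes
   A i powi (- g i) * \<zeta> powi (i * t i) by the factor \<zeta> powi (- m * \<phi> i).  A criterion that
   evaluates this expression therefore has to fix g i modulo q - 1; the representative
   for which it describes the inverse map is the exponent r (\<phi> i).
   With congruence modulo s alone the criterion fails: for q = 17, \<gamma> = 3, l = 2,
   A = (1, 13), r = (1, 1), take g = (1, 9), t = (0, -1); the polynomial is x on squares
   and 13 * x on non-squares, and 13 * 13 = -1. *)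
definition matched_inverse_exponents ::
  "nat \<Rightarrow> nat \<Rightarrow> (nat \<Rightarrow> nat) \<Rightarrow> (nat \<Rightarrow> nat) \<Rightarrow> (nat \<Rightarrow> int) \<Rightarrow> bool" where
  "matched_inverse_exponents q l \<phi> r g \<longleftrightarrow>
     (\<forall>i<l. [int (r (\<phi> i)) = g i] (mod (int q - 1)))"

end

theory Submission
  imports Defs
begin

text \<open>
  On the coset of the nonzero elements \<open>\<gamma> ^ n\<close> with \<open>n \<equiv> i (mod l)\<close> the polynomial is the monomial
  \<open>A i * x ^ r i\<close>, because the inner sums are geometric sums of \<open>l\<close>-th roots of unity.  It sends
  coset \<open>i\<close> to coset \<open>\<phi> i\<close>, so, on exponents of \<open>\<gamma>\<close>, being an involution means
  \<open>a (\<phi> i) + (a i + n * r i) * r (\<phi> i) \<equiv> n (mod q - 1)\<close> for all \<open>n \<equiv> i (mod l)\<close>, where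
  \<open>A i = \<gamma> ^ a i\<close>.  Comparing \<open>n = i\<close> with \<open>n = i + l\<close> shows that \<open>r (\<phi> i)\<close> inverts \<open>r i\<close> modulo \<open>s\<close>,
  and \<open>n = i\<close> gives the condition on the coefficients.
\<close>

section \<open>Finite fields and exponents of a primitive element\<close>

text \<open>Multiplication by \<open>a\<close> permutes the nonzero elements, so it leaves their
  product unchanged; cancelling that product gives the claim.\<close>

lemma power_card_minus_1_eq_1:
  fixes a :: "'a::{field,finite}"
  assumes "a \<noteq> 0"
  shows "a ^ (CARD('a) - 1) = 1"
proof -
  let ?U = "UNIV - {0::'a}"
  have "bij_betw ((*) a) ?U ?U"
    by (rule bij_betw_byWitness[where f' = "\<lambda>x. x / a"]) (use assms in auto)
  then have "(\<Prod>x\<in>?U. x) = (\<Prod>x\<in>?U. a * x)"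
    by (rule prod.reindex_bij_betw[symmetric])
  also have "\<dots> = a ^ card ?U * (\<Prod>x\<in>?U. x)"
    by (simp add: prod.distrib)
  finally show ?thesis
    by (simp add: card_Diff_singleton)
qed

lemma card_field_ge_2: "2 \<le> CARD('a::{field,finite})"
  using card_mono[of "UNIV :: 'a::{field,finite} set" "{0, 1}"] by simp

context
  fixes \<gamma> :: "'a::{field,finite}"
  assumes primitive: "primitive_element \<gamma>"
begin

lemma primitive_element_nonzero: "\<gamma> \<noteq> 0"
  using primitive by (simp add: primitive_element_def)

lemma primitive_power_mod: "\<gamma> ^ (n mod (CARD('a) - 1)) = \<gamma> ^ n"
proof -
  have "\<gamma> ^ n = \<gamma> ^ ((CARD('a) - 1) * (n div (CARD('a) - 1)) + n mod (CARD('a) - 1))"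
    by simp
  also have "\<dots> = \<gamma> ^ (n mod (CARD('a) - 1))"
    by (simp only: power_add power_mult power_card_minus_1_eq_1[OF primitive_element_nonzero]
        power_one mult_1_left)
  finally show ?thesis ..
qed

text \<open>Primitivity and reduction of exponents give surjectivity; both sets have
  \<open>CARD('a) - 1\<close> elements, so injectivity follows by counting.\<close>

lemma bij_betw_primitive_power: "bij_betw ((^) \<gamma>) {..<CARD('a) - 1} (UNIV - {0})"
proof -
  have image: "(^) \<gamma> ` {..<CARD('a) - 1} = UNIV - {0}"
  proof (intro equalityI subsetI)
    fix a assume "a \<in> UNIV - {0 :: 'a}"
    then obtain n where "a = \<gamma> ^ n"
      using primitive by (auto simp: primitive_element_def)
    then have "a = \<gamma> ^ (n mod (CARD('a) - 1))"
      by (simp only: primitive_power_mod)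
    then show "a \<in> (^) \<gamma> ` {..<CARD('a) - 1}"
      using card_field_ge_2[where 'a = 'a] by auto
  qed (auto simp: primitive_element_nonzero)
  moreover have "card (UNIV - {0 :: 'a}) = CARD('a) - 1"
    by (simp add: card_Diff_singleton)
  ultimately have "inj_on ((^) \<gamma>) {..<CARD('a) - 1}"
    by (intro eq_card_imp_inj_on) auto
  with image show ?thesis
    by (simp add: bij_betw_def)
qed

lemma primitive_power_eq_1_iff: "\<gamma> ^ n = 1 \<longleftrightarrow> CARD('a) - 1 dvd n"
proof
  assume "\<gamma> ^ n = 1"
  then have "\<gamma> ^ (n mod (CARD('a) - 1)) = \<gamma> ^ 0"
    by (simp only: primitive_power_mod power_0)
  then have "n mod (CARD('a) - 1) = 0"
    by (rule inj_onD[OF bij_betw_imp_inj_on[OF bij_betw_primitive_power]])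
      (use card_field_ge_2[where 'a = 'a] in auto)
  then show "CARD('a) - 1 dvd n"
    by (simp add: dvd_eq_mod_eq_0)
qed (auto simp: power_mult power_card_minus_1_eq_1[OF primitive_element_nonzero, simplified])

lemma primitive_powi_eq_1_iff: "\<gamma> powi m = 1 \<longleftrightarrow> int (CARD('a) - 1) dvd m"
proof (cases "m \<ge> 0")
  case True
  then obtain n where "m = int n"
    using nonneg_int_cases by blast
  then show ?thesis
    by (simp only: primitive_power_eq_1_iff int_dvd_int_iff power_int_of_nat)
next
  case False
  then obtain n where "m = - int n"
    by (metis int_cases4 le_less linear of_nat_0_le_iff)
  then show ?thesis
    by (simp only: primitive_power_eq_1_iff power_int_minus int_dvd_int_iff power_int_of_nat
        inverse_eq_1_iff dvd_minus_iff)
qed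

text \<open>This translates field equations into congruences of exponents. The exponents are
  integers because the coefficient condition involves negative ones.\<close>

lemma primitive_powi_eq_iff:
  "\<gamma> powi m = \<gamma> powi n \<longleftrightarrow> [m = n] (mod (int CARD('a) - 1))"
proof -
  have "\<gamma> powi m = \<gamma> powi n \<longleftrightarrow> \<gamma> powi (m - n) = 1"
    by (simp add: power_int_diff primitive_element_nonzero)
  then show ?thesis
    using card_field_ge_2[where 'a = 'a] by (simp add: primitive_powi_eq_1_iff cong_iff_dvd_diff of_nat_diff)
qed

text \<open>The bijection supplies the existence and uniqueness that the definite description in
  \<open>ind\<close> needs.\<close>

lemma power_ind:
  assumes "a \<noteq> 0"
  shows "\<gamma> ^ ind \<gamma> a = a"
proof -
  have less: "e \<le> CARD('a) - 2 \<longleftrightarrow> e < CARD('a) - 1" for e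
    using card_field_ge_2[where 'a = 'a] by auto
  have "a \<in> (^) \<gamma> ` {..<CARD('a) - 1}"
    unfolding bij_betw_imp_surj_on[OF bij_betw_primitive_power] using assms by simp
  then obtain n where n: "n < CARD('a) - 1" "\<gamma> ^ n = a"
    by auto
  have "inj_on ((^) \<gamma>) {..<CARD('a) - 1}"
    using bij_betw_primitive_power by (rule bij_betw_imp_inj_on)
  then have "\<exists>!e. e \<le> CARD('a) - 2 \<and> \<gamma> ^ e = a"
    using n unfolding less by (intro ex1I[of _ n]) (auto dest: inj_onD)
  from theI'[OF this] show ?thesis
    by (simp add: ind_def)
qed

section \<open>Root-of-unity sums and values of the polynomial on cosets\<close>

text \<open>The ratio of this geometric sum is an \<open>l\<close>-th root of unity, and it is 1
  exactly when \<open>l\<close> divides \<open>k\<close>.\<close>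

lemma root_of_unity_sum:
  assumes "0 < l" "l * s = CARD('a) - 1"
  shows "(\<Sum>j<l. (\<gamma> powi (int s * k)) ^ j) = (if int l dvd k then of_nat l else 0)"
proof -
  have s: "s \<noteq> 0"
    using assms card_field_ge_2[where 'a = 'a] by (cases s) auto
  have unit: "\<gamma> powi (int s * k) = 1 \<longleftrightarrow> int l dvd k"
    unfolding primitive_powi_eq_1_iff assms(2)[symmetric]
    using s by (simp add: mult.commute[of "int l"])
  have "(\<gamma> powi (int s * k)) ^ l = \<gamma> powi (int s * k * int l)"
    by (simp add: power_int_mult)
  also have "\<dots> = 1"
    unfolding primitive_powi_eq_1_iff assms(2)[symmetric] by simp
  finally show ?thesis
    by (simp add: sum_gp_strict unit)
qed

text \<open>If \<open>l\<close> vanished in the field, so would \<open>l * s\<close>, and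
  \<open>CARD('a) = l * s + 1\<close> would be 1 there; but the characteristic divides
  \<open>CARD('a)\<close>.\<close>

lemma of_nat_divisor_nonzero:
  assumes "l * s = CARD('a) - 1"
  shows "(of_nat l :: 'a) \<noteq> 0"
proof
  assume "(of_nat l :: 'a) = 0"
  then have "(of_nat (l * s) :: 'a) = 0"
    by simp
  then have "(of_nat (Suc (l * s)) :: 'a) = 1"
    by simp
  moreover have "Suc (l * s) = CARD('a)"
    using assms card_field_ge_2[where 'a = 'a] by simp
  moreover have "(of_nat CARD('a) :: 'a) = 0"
    using CHAR_dvd_CARD[where 'a = 'a] by (simp add: of_nat_eq_0_iff_char_dvd)
  ultimately show False
    by simp
qed

lemma poly_cyc_poly_0:
  assumes "\<And>i. i < l \<Longrightarrow> 0 < r i"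
  shows "poly (cyc_poly \<gamma> l A r) 0 = 0"
  using assms by (auto simp: cyc_poly_def Let_def poly_sum poly_monom intro!: sum.neutral)

text \<open>At \<open>\<gamma> ^ n\<close> the inner sum for index \<open>k\<close> is a
  root-of-unity sum that vanishes unless \<open>k\<close> is the class of \<open>n\<close>; the
  surviving factor \<open>l\<close> cancels \<open>1 / l\<close>.\<close>

lemma poly_cyc_poly_power:
  assumes "0 < l" "l dvd CARD('a) - 1" "i < l" "[n = i] (mod l)"
  shows "poly (cyc_poly \<gamma> l A r) (\<gamma> ^ n) = A i * \<gamma> ^ (n * r i)"
proof -
  define s where "s = (CARD('a) - 1) div l"
  have ls: "l * s = CARD('a) - 1"
    using assms by (simp add: s_def)
  \<comment> \<open>Collecting the powers of \<open>\<gamma>\<close> shows that the dependence on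
    \<open>j\<close> is geometric, with ratio \<open>\<gamma> powi (s * (n - k))\<close>.\<close>
  have summand: "A k * (\<gamma> ^ s) powi (- (int j * int k)) * (\<gamma> ^ n) ^ (r k + j * s) =
      A k * \<gamma> ^ (n * r k) * (\<gamma> powi (int s * (int n - int k))) ^ j" for j k
  proof -
    have "(\<gamma> ^ s) powi (- (int j * int k)) * (\<gamma> ^ n) ^ (r k + j * s) =
        \<gamma> powi (int s * (- (int j * int k)) + int (n * (r k + j * s)))"
      by (simp only: power_int_add[OF disjI1, OF primitive_element_nonzero] power_int_mult
          power_int_of_nat power_mult)
    also have "int s * (- (int j * int k)) + int (n * (r k + j * s)) =
        int (n * r k) + int s * (int n - int k) * int j"
      by (simp add: algebra_simps)
    also have "\<gamma> powi \<dots> = \<gamma> ^ (n * r k) * (\<gamma> powi (int s * (int n - int k))) ^ j"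
      by (simp only: power_int_add[OF disjI1, OF primitive_element_nonzero]
          power_int_mult[of _ _ "int j"] power_int_of_nat)
    finally show ?thesis
      by (simp add: mult.assoc)
  qed
  have same_coset: "int l dvd int n - int k \<longleftrightarrow> k = i" if "k < l" for k
  proof -
    have "int l dvd int n - int k \<longleftrightarrow> [n = k] (mod l)"
      by (simp add: cong_iff_dvd_diff flip: cong_int_iff)
    also have "\<dots> \<longleftrightarrow> k = i"
      using assms that by (auto simp: cong_def)
    finally show ?thesis .
  qed
  have "poly (cyc_poly \<gamma> l A r) (\<gamma> ^ n) =
      1 / of_nat l * (\<Sum>k<l. A k * \<gamma> ^ (n * r k) * (\<Sum>j<l. (\<gamma> powi (int s * (int n - int k))) ^ j))"
    by (simp only: cyc_poly_def Let_def poly_smult poly_sum poly_monom summand sum_distrib_left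
        flip: s_def)
  also have "(\<Sum>k<l. A k * \<gamma> ^ (n * r k) * (\<Sum>j<l. (\<gamma> powi (int s * (int n - int k))) ^ j)) =
      (\<Sum>k<l. if k = i then A k * \<gamma> ^ (n * r k) * of_nat l else 0)"
    by (intro sum.cong refl) (simp add: root_of_unity_sum[OF assms(1) ls] same_coset)
  also have "\<dots> = A i * \<gamma> ^ (n * r i) * of_nat l"
    using assms by simp
  finally show ?thesis
    using of_nat_divisor_nonzero[OF ls] by simp
qed

end

section \<open>The involution criterion\<close>

lemma complete_residue_set_lessThan:
  assumes "0 < l"
  shows "complete_residue_set l {..<l}"
  unfolding complete_residue_set_def
proof
  fix n
  show "\<exists>!k. k \<in> {..<l} \<and> [k = n] (mod l)"
    by (rule ex1I[of _ "n mod l"]) (use assms in \<open>auto simp: cong_def\<close>)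
qed

theorem theorem2:
  fixes \<gamma> \<zeta> :: "'a::{field,finite}"
    and q l s :: nat
    and A :: "nat \<Rightarrow> 'a"
    and r \<phi> :: "nat \<Rightarrow> nat"
    and P :: "'a poly"
  assumes q: "q = CARD('a)"
    and l: "0 < l" "l dvd q - 1"
    and s: "s = (q - 1) div l"
    and \<gamma>: "primitive_element \<gamma>"
    and \<zeta>: "\<zeta> = \<gamma> ^ s"
    and A: "\<And>i. i < l \<Longrightarrow> A i \<noteq> 0"
    and r: "\<And>i. i < l \<Longrightarrow> 0 < r i"
    and P: "P = cyc_poly \<gamma> l A r"
    and \<phi>: "\<And>i. i < l \<Longrightarrow> \<phi> i = (ind \<gamma> (A i) + i * r i) mod l"
  shows "(\<forall>x. poly P (poly P x) = x) \<longleftrightarrow>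
    (\<exists>g t :: nat \<Rightarrow> int.
       (\<forall>i<l. int (r i) * g i + int s * t i = 1) \<and>
       complete_residue_set l (\<phi> ` {..<l}) \<and>
       (\<forall>i<l. [int (r (\<phi> i)) = modular_inverse (int s) (int (r i))] (mod int s) \<and>
              [modular_inverse (int s) (int (r i)) = g i] (mod int s)) \<and>
       matched_inverse_exponents q l \<phi> r g \<and>
       (\<forall>i<l. A (\<phi> i) = A i powi (- g i) * \<zeta> powi (int i * t i)))"
proof -
  define a where "a i = ind \<gamma> (A i)" for i
  define Q where "Q = int q - 1"
  have q2: "2 \<le> q"
    using card_field_ge_2[where 'a = 'a] by (simp add: q)
  have ls: "l * s = q - 1"
    using l s by simp
  have Q: "Q = int l * int s"
    using q2 ls by (metis Q_def of_nat_1 of_nat_diff of_nat_mult one_le_numeral order_trans)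
  have s0: "s > 0"
    using ls q2 by (cases s) auto
  have A_power: "A i = \<gamma> ^ a i" if "i < l" for i
    using power_ind[OF \<gamma> A[OF that]] by (simp add: a_def)
  have \<phi>_less: "\<phi> i < l" if "i < l" for i
    using \<phi>[OF that] l by simp
  have P_power: "poly P (\<gamma> ^ n) = \<gamma> ^ (a i + n * r i)" if "i < l" "[n = i] (mod l)" for n i
    using poly_cyc_poly_power[OF \<gamma> l(1), of i n A r] that l(2) A_power[OF that(1)]
    by (simp add: P q power_add)
  \<comment> \<open>The exponent of the image, taken modulo \<open>l\<close>, depends only on the
    class of \<open>n\<close>; hence \<open>P\<close> maps coset \<open>i\<close> into coset
    \<open>\<phi> i\<close>.\<close>
  have \<phi>_class: "[a i + n * r i = \<phi> i] (mod l)" if "i < l" "[n = i] (mod l)" for n i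
  proof -
    have "[a i + n * r i = a i + i * r i] (mod l)"
      by (intro cong_add cong_mult cong_refl that)
    then show ?thesis
      using \<phi>[OF that(1)] by (simp add: a_def cong_def)
  qed
  have powi_eq: "\<gamma> powi m = \<gamma> powi n \<longleftrightarrow> [m = n] (mod Q)" for m n
    using primitive_powi_eq_iff[OF \<gamma>] by (simp add: Q_def q)
  have power_eq: "\<gamma> ^ m = \<gamma> ^ n \<longleftrightarrow> [int m = int n] (mod Q)" for m n
    using powi_eq[of "int m" "int n"] by simp
  have PP_power: "poly P (poly P (\<gamma> ^ n)) = \<gamma> ^ (a (\<phi> i) + (a i + n * r i) * r (\<phi> i))"
    if "i < l" "[n = i] (mod l)" for n i
    using P_power[OF that] P_power[OF \<phi>_less[OF that(1)] \<phi>_class[OF that]] by simp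
  \<comment> \<open>The coefficient condition in logarithmic form, for arbitrary exponents
    \<open>h\<close> and \<open>u\<close> so that it serves both directions.\<close>
  have coeff_iff: "A (\<phi> i) = A i powi (- h) * \<zeta> powi (int i * u) \<longleftrightarrow>
      [int (a (\<phi> i)) = - h * int (a i) + int s * int i * u] (mod Q)" if "i < l" for i h u
  proof -
    have "A i powi (- h) * \<zeta> powi (int i * u) = \<gamma> powi (int (a i) * (- h) + int s * (int i * u))"
      using primitive_element_nonzero[OF \<gamma>]
      by (simp only: A_power[OF that] \<zeta> power_int_add[OF disjI1] power_int_mult power_int_of_nat
          not_False_eq_True)
    moreover have "A (\<phi> i) = \<gamma> powi int (a (\<phi> i))"
      using A_power[OF \<phi>_less[OF that]] by simp
    ultimately show ?thesis
      by (simp only: powi_eq) (simp add: algebra_simps)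
  qed
  show ?thesis
  proof
    assume inv: "\<forall>x. poly P (poly P x) = x"
    have exponents: "[int (a (\<phi> i)) + (int (a i) + int n * int (r i)) * int (r (\<phi> i)) = int n] (mod Q)"
      if "i < l" "[n = i] (mod l)" for i n
      using PP_power[OF that] inv power_eq[of "a (\<phi> i) + (a i + n * r i) * r (\<phi> i)" n] by simp
    have inverse: "[int (r i) * int (r (\<phi> i)) = 1] (mod int s)" if "i < l" for i
    proof -
      \<comment> \<open>Subtracting the congruences for \<open>i\<close> and \<open>i + l\<close>
        leaves \<open>l\<close> times the desired one modulo \<open>l * s\<close>; cancelling
        \<open>l\<close> leaves the modulus \<open>s\<close>.\<close>
      have "[int (a (\<phi> i)) + (int (a i) + int (i + l) * int (r i)) * int (r (\<phi> i))
          - (int (a (\<phi> i)) + (int (a i) + int i * int (r i)) * int (r (\<phi> i)))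
          = int (i + l) - int i] (mod Q)"
        by (intro cong_diff exponents that) (auto simp: cong_def)
      then have "[int l * (int (r i) * int (r (\<phi> i))) = int l * 1] (mod (int l * int s))"
        by (simp add: Q algebra_simps)
      then show ?thesis
        using l(1) unfolding cong_iff_dvd_diff right_diff_distrib[symmetric] by simp
    qed
    \<comment> \<open>Taking \<open>r (\<phi> i)\<close> itself as Bezout coefficient makes
      \<open>matched_inverse_exponents\<close> immediate; the division defining \<open>t\<close> is
      exact by \<open>inverse\<close>.\<close>
    define g where "g i = int (r (\<phi> i))" for i
    define t where "t i = (1 - int (r i) * g i) div int s" for i
    have bezout: "int (r i) * g i + int s * t i = 1" if "i < l" for i
      using inverse[OF that] by (simp add: t_def g_def cong_iff_dvd_diff dvd_diff_commute)
    \<comment> \<open>Modulo \<open>l\<close> the exponent of \<open>P (P (\<gamma> ^ i))\<close> is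
      \<open>\<phi> (\<phi> i)\<close>, and the involution makes it \<open>i\<close>. So
      \<open>\<phi>\<close> is its own inverse on the indices.\<close>
    have \<phi>\<phi>: "\<phi> (\<phi> i) = i" if "i < l" for i
    proof -
      have "int l dvd Q"
        by (simp add: Q)
      with exponents[OF that cong_refl]
      have "[int (a (\<phi> i) + (a i + i * r i) * r (\<phi> i)) = int i] (mod int l)"
        by (auto intro: cong_dvd_modulus)
      then have "[a (\<phi> i) + (a i + i * r i) * r (\<phi> i) = i] (mod l)"
        by (simp only: cong_int_iff)
      moreover have "[a (\<phi> i) + (a i + i * r i) * r (\<phi> i) = \<phi> (\<phi> i)] (mod l)"
        by (intro \<phi>_class \<phi>_less that cong_refl)
      ultimately show ?thesis
        using that \<phi>_less by (simp add: cong_def)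
    qed
    have "bij_betw \<phi> {..<l} {..<l}"
      by (rule bij_betw_byWitness[where f' = \<phi>]) (use \<phi>_less \<phi>\<phi> in auto)
    then have "\<phi> ` {..<l} = {..<l}"
      by (rule bij_betw_imp_surj_on)
    then have "complete_residue_set l (\<phi> ` {..<l})"
      using complete_residue_set_lessThan[OF l(1)] by simp
    moreover have "[modular_inverse (int s) (int (r i)) = int (r (\<phi> i))] (mod int s)" if "i < l" for i
    proof -
      \<comment> \<open>The modular inverse is a reduced residue, hence the \<open>mod int s\<close>
        on the right.\<close>
      have "modular_inverse (int s) (int (r i)) = int (r (\<phi> i)) mod int s"
        using inverse[OF that] s0 by (intro modular_inverse_int_eqI) (auto simp: cong_def mod_simps)
      then show ?thesis
        by simp
    qed
    moreover have "A (\<phi> i) = A i powi (- g i) * \<zeta> powi (int i * t i)" if "i < l" for i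
    proof -
      have st: "int s * t i = 1 - int (r i) * g i"
        using bezout[OF that] by simp
      \<comment> \<open>After eliminating \<open>s * t i\<close> by Bezout, the two sides of the
        coefficient congruence differ by the same integer as those of \<open>exponents\<close> at
        \<open>n = i\<close>.\<close>
      have "int (a (\<phi> i)) - (- g i * int (a i) + int s * int i * t i)
          = int (a (\<phi> i)) + g i * int (a i) - int i * (int s * t i)"
        by (simp add: algebra_simps)
      also have "\<dots>
          = int (a (\<phi> i)) + (int (a i) + int i * int (r i)) * int (r (\<phi> i)) - int i"
        unfolding st by (simp add: g_def algebra_simps)
      finally show ?thesis
        using exponents[OF that cong_refl] unfolding coeff_iff[OF that] cong_iff_dvd_diff
        by (simp only:)
    qed
    ultimately show "\<exists>g t :: nat \<Rightarrow> int.
       (\<forall>i<l. int (r i) * g i + int s * t i = 1) \<and>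
       complete_residue_set l (\<phi> ` {..<l}) \<and>
       (\<forall>i<l. [int (r (\<phi> i)) = modular_inverse (int s) (int (r i))] (mod int s) \<and>
              [modular_inverse (int s) (int (r i)) = g i] (mod int s)) \<and>
       matched_inverse_exponents q l \<phi> r g \<and>
       (\<forall>i<l. A (\<phi> i) = A i powi (- g i) * \<zeta> powi (int i * t i))"
      using bezout
      by (intro exI[of _ g] exI[of _ t]) (simp add: matched_inverse_exponents_def g_def cong_sym)
  next
    assume "\<exists>g t :: nat \<Rightarrow> int.
       (\<forall>i<l. int (r i) * g i + int s * t i = 1) \<and>
       complete_residue_set l (\<phi> ` {..<l}) \<and>
       (\<forall>i<l. [int (r (\<phi> i)) = modular_inverse (int s) (int (r i))] (mod int s) \<and>
              [modular_inverse (int s) (int (r i)) = g i] (mod int s)) \<and>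
       matched_inverse_exponents q l \<phi> r g \<and>
       (\<forall>i<l. A (\<phi> i) = A i powi (- g i) * \<zeta> powi (int i * t i))"
    then obtain g t :: "nat \<Rightarrow> int" where
        bezout: "\<And>i. i < l \<Longrightarrow> int (r i) * g i + int s * t i = 1"
      and matched: "\<And>i. i < l \<Longrightarrow> [int (r (\<phi> i)) = g i] (mod Q)"
      and coeff: "\<And>i. i < l \<Longrightarrow> A (\<phi> i) = A i powi (- g i) * \<zeta> powi (int i * t i)"
      by (auto simp: matched_inverse_exponents_def Q_def)
    show "\<forall>x. poly P (poly P x) = x"
    proof
      fix x
      show "poly P (poly P x) = x"
      proof (cases "x = 0")
        case True
        then show ?thesis
          using poly_cyc_poly_0[OF \<gamma>] r by (simp add: P)
      next
        case False
        then obtain n where x: "x = \<gamma> ^ n"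
          using \<gamma> by (auto simp: primitive_element_def)
        define i where "i = n mod l"
        have i: "i < l" "[n = i] (mod l)"
          using l by (auto simp: i_def cong_def)
        \<comment> \<open>The logarithm of \<open>A (\<phi> i)\<close> comes from the coefficient
          condition, and \<open>r (\<phi> i)\<close> is replaced by \<open>g i\<close>, which uses
          their congruence modulo \<open>Q\<close> and not just modulo \<open>s\<close>.\<close>
        have "[int (a (\<phi> i)) + (int (a i) + int n * int (r i)) * int (r (\<phi> i))
            = (- g i * int (a i) + int s * int i * t i) + (int (a i) + int n * int (r i)) * g i] (mod Q)"
          using coeff[OF i(1)] unfolding coeff_iff[OF i(1)]
          by (intro cong_add cong_mult cong_refl matched i)
        \<comment> \<open>The terms in \<open>a i\<close> cancel; Bezout then turns the rest into
          \<open>n\<close> minus an error term.\<close>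
        also have "(- g i * int (a i) + int s * int i * t i) + (int (a i) + int n * int (r i)) * g i
            = int s * t i * int i + int n * (int (r i) * g i)"
          by (simp add: algebra_simps)
        also have "int (r i) * g i = 1 - int s * t i"
          using bezout[OF i(1)] by simp
        also have "int s * t i * int i + int n * (1 - int s * t i)
            = int n - int s * (int n - int i) * t i"
          by (simp add: algebra_simps)
        also have "[int n - int s * (int n - int i) * t i = int n - 0] (mod Q)"
        proof (intro cong_diff cong_refl)
          \<comment> \<open>The error carries the factor \<open>s\<close>, and \<open>n - i\<close>
            contributes the missing \<open>l\<close>, so it vanishes modulo
            \<open>Q = l * s\<close>.\<close>
          have "int l dvd int n - int i"
            using i(2) by (simp add: cong_iff_dvd_diff flip: cong_int_iff)
          then show "[int s * (int n - int i) * t i = 0] (mod Q)"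
            by (simp add: Q cong_0_iff mult.commute[of "int l"] mult_dvd_mono)
        qed
        finally show ?thesis
          unfolding x PP_power[OF i] power_eq by simp
      qed
    qed
  qed
qed

end
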